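(* Let $\sigma>0$, let $X$ be a normed vector space, let $K\subset X$ be nonempty and convex, and let $f\colon K\to\mathbb{R}$ be $\sigma$-strongly quasiconvex and such that $f$ is lower semicontinuous at some point $x_0\in K$. Then $f$ is $2$-supercoercive on $K$.
   Context: All normed vector spaces are real and nontrivial. For $\sigma>0$, $f\colon K\to\mathbb{R}$ is $\sigma$-strongly quasiconvex if $f(\lambda x+(1-\lambda)y)\le\max\{f(x),f(y)\}-\frac{\sigma}{2}\lambda(1-\lambda)\|x-y\|^2$ for all $x,y\in K$ and $0<\lambda<1$. Let $n$ be a positive integer. A function $g\colon X\to[-\infty,\infty]$ is $n$-supercoercive if $\liminf_{\|x\|\to\infty}\frac{g(x)}{\|x\|^n}>0$. For $f\colon K\to\mathbb{R}$, $f$ is $n$-supercoercive on $K$ if the function $g\colon X\to[-\infty,\infty]$ given by $g(x)=f(x)$ for $x\in K$ and $g(x)=\infty$ for $x\in X\setminus K$ is $n$-supercoercive. Lower semicontinuity of $f$ at $x_0$ is understood relative to $K$. *)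

theory Defs
  imports "HOL-Analysis.Analysis"
begin

text \<open>A function \<open>f : K \<rightarrow> \<real>\<close> is represented by a total function of which only the values on
  \<open>K\<close> are used.\<close>

definition strongly_quasiconvex_on ::
  "real \<Rightarrow> 'a::real_normed_vector set \<Rightarrow> ('a \<Rightarrow> real) \<Rightarrow> bool" where
  "strongly_quasiconvex_on \<sigma> K f \<longleftrightarrow>
     (\<forall>x\<in>K. \<forall>y\<in>K. \<forall>l::real. 0 < l \<and> l < 1 \<longrightarrow>
        f (l *\<^sub>R x + (1 - l) *\<^sub>R y)
          \<le> max (f x) (f y) - \<sigma> / 2 * l * (1 - l) * (norm (x - y))\<^sup>2)"

definition lsc_at_within ::
  "'a::topological_space \<Rightarrow> 'a set \<Rightarrow> ('a \<Rightarrow> real) \<Rightarrow> bool" where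
  "lsc_at_within x0 K f \<longleftrightarrow> (\<forall>c < f x0. eventually (\<lambda>x. c < f x) (at x0 within K))"

text \<open>Used for \<open>n \<ge> 1\<close>. The value of the quotient at \<open>x = 0\<close> does not affect the limit inferior.\<close>

definition supercoercive :: "nat \<Rightarrow> ('a::real_normed_vector \<Rightarrow> ereal) \<Rightarrow> bool" where
  "supercoercive n g \<longleftrightarrow> Liminf at_infinity (\<lambda>x. g x / ereal (norm x ^ n)) > 0"

definition supercoercive_on ::
  "nat \<Rightarrow> 'a::real_normed_vector set \<Rightarrow> ('a \<Rightarrow> real) \<Rightarrow> bool" where
  "supercoercive_on n K f \<longleftrightarrow> supercoercive n (\<lambda>x. if x \<in> K then ereal (f x) else \<infinity>)"

end

theory Submission
  imports Defs
begin

text \<open>Lower semicontinuity bounds \<open>f\<close> below by \<open>f x0 - 1\<close> near \<open>x0\<close>. Applying strong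
  quasiconvexity on \<open>[x0, x]\<close> at the point at a fixed small distance from \<open>x0\<close> then gives a
  linear lower bound for \<open>max (f x) (f x0)\<close>, hence \<open>f x \<ge> f x0\<close> far from \<open>x0\<close>. For \<open>x\<close> twice as
  far away the midpoint of \<open>[x0, x]\<close> also has value at least \<open>f x0\<close>, and strong quasiconvexity at
  the midpoint gives \<open>f x \<ge> f x0 + \<sigma>/8 * norm (x - x0)\<^sup>2\<close>.\<close>

lemma strongly_quasiconvex_onD:
  assumes "strongly_quasiconvex_on \<sigma> K f" "x \<in> K" "y \<in> K" "0 < l" "l < 1"
  shows "f (l *\<^sub>R x + (1 - l) *\<^sub>R y)
           \<le> max (f x) (f y) - \<sigma> / 2 * l * (1 - l) * (norm (x - y))\<^sup>2"
  using assms unfolding strongly_quasiconvex_on_def by blast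

lemma strongly_quasiconvex_on_ge_far:
  fixes f :: "'a::real_normed_vector \<Rightarrow> real"
  assumes "\<sigma> > 0" "convex K" "strongly_quasiconvex_on \<sigma> K f" "x0 \<in> K" "lsc_at_within x0 K f"
  obtains R where "R > 0" "\<And>x. x \<in> K \<Longrightarrow> norm (x - x0) \<ge> R \<Longrightarrow> f x \<ge> f x0"
proof -
  have "\<forall>\<^sub>F x in at x0 within K. f x0 - 1 < f x"
    using assms(5) unfolding lsc_at_within_def by auto
  then obtain d where d: "d > 0"
      "\<And>x. x \<in> K \<Longrightarrow> x \<noteq> x0 \<Longrightarrow> dist x x0 < d \<Longrightarrow> f x0 - 1 < f x"
    unfolding eventually_at by blast
  define s where "s = d / 2"
  have s: "0 < s" "s < d" using d(1) by (auto simp: s_def)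
  \<comment> \<open>This \<open>R\<close> solves \<open>\<sigma> * s / 2 * (R - s) = 1\<close>: from
    there on the quasiconvexity penalty uses up the slack 1 in
    \<open>f x0 - 1 < f z\<close>.\<close>
  define R where "R = s + 2 / (\<sigma> * s)"
  have "R > s" using s assms(1) by (simp add: R_def)
  have "f x \<ge> f x0" if x: "x \<in> K" "norm (x - x0) \<ge> R" for x
  proof (rule ccontr)
    assume less: "\<not> f x \<ge> f x0"
    define r where "r = norm (x - x0)"
    have r: "r \<ge> R" "r > s" "r > 0" using x \<open>R > s\<close> s by (auto simp: r_def)
    \<comment> \<open>Puts \<open>z\<close> at distance exactly \<open>s\<close> from
      \<open>x0\<close>: inside the ball of radius \<open>d\<close>, yet different from
      \<open>x0\<close>.\<close>
    define l where "l = s / r"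
    have l: "0 < l" "l < 1" using r s by (auto simp: l_def)
    define z where "z = l *\<^sub>R x + (1 - l) *\<^sub>R x0"
    have "z \<in> K" unfolding z_def using assms(2,4) x(1) l by (intro convexD) auto
    have "z - x0 = l *\<^sub>R (x - x0)" by (simp add: z_def algebra_simps)
    then have "norm (z - x0) = s" using s r by (simp add: r_def[symmetric] l_def)
    then have "f x0 - 1 < f z" using d(2)[OF \<open>z \<in> K\<close>] s by (auto simp: dist_norm)
    also have "f z \<le> max (f x) (f x0) - \<sigma> / 2 * l * (1 - l) * r\<^sup>2"
      unfolding z_def r_def by (rule strongly_quasiconvex_onD) (use assms x l in auto)
    \<comment> \<open>As \<open>l * r = s\<close>, the factor \<open>l * (1 - l) * r\<^sup>2\<close>
      is \<open>s * (r - s)\<close>, linear in \<open>r\<close>.\<close>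
    also have "\<sigma> / 2 * l * (1 - l) * r\<^sup>2 = \<sigma> * s / 2 * (r - s)"
      using r(3) by (simp add: l_def field_simps power2_eq_square)
    \<comment> \<open>By \<open>less\<close> the maximum is \<open>f x0\<close>, which
      cancels.\<close>
    finally have "\<sigma> * s / 2 * (r - s) < 1" using less by simp
    moreover have "\<sigma> * s / 2 * (r - s) \<ge> \<sigma> * s / 2 * (2 / (\<sigma> * s))"
      using r(1) assms(1) s by (intro mult_left_mono) (auto simp: R_def)
    moreover have "\<sigma> * s / 2 * (2 / (\<sigma> * s)) = 1" using assms(1) s by simp
    ultimately show False by linarith
  qed
  moreover have "R > 0" using \<open>R > s\<close> s by simp
  ultimately show ?thesis using that by blast
qed

lemma strongly_quasiconvex_on_quadratic_growth:
  fixes f :: "'a::real_normed_vector \<Rightarrow> real"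
  assumes "\<sigma> > 0" "convex K" "strongly_quasiconvex_on \<sigma> K f" "x0 \<in> K" "lsc_at_within x0 K f"
  obtains R where
    "\<And>x. x \<in> K \<Longrightarrow> norm (x - x0) \<ge> R \<Longrightarrow> f x \<ge> f x0 + \<sigma> / 8 * (norm (x - x0))\<^sup>2"
proof -
  obtain R where R: "R > 0" "\<And>x. x \<in> K \<Longrightarrow> norm (x - x0) \<ge> R \<Longrightarrow> f x \<ge> f x0"
    using strongly_quasiconvex_on_ge_far[OF assms] by blast
  \<comment> \<open>The radius \<open>2 * R\<close> keeps the midpoint \<open>m\<close> at distance
    at least \<open>R\<close> from \<open>x0\<close>.\<close>
  have "f x \<ge> f x0 + \<sigma> / 8 * (norm (x - x0))\<^sup>2" if x: "x \<in> K" "norm (x - x0) \<ge> 2 * R" for x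
  proof -
    define m where "m = (1/2) *\<^sub>R x + (1 - 1/2) *\<^sub>R x0"
    have "m \<in> K" unfolding m_def using assms(2,4) x(1) by (intro convexD) auto
    have "m - x0 = (1/2) *\<^sub>R (x - x0)"
      unfolding m_def by (simp only: scaleR_diff_left scaleR_diff_right scaleR_one) simp
    then have "norm (m - x0) \<ge> R" using x(2) by simp
    then have "f x0 \<le> f m" using R(2) \<open>m \<in> K\<close> by blast
    also have "f m \<le> max (f x) (f x0) - \<sigma> / 2 * (1/2) * (1 - 1/2) * (norm (x - x0))\<^sup>2"
      unfolding m_def by (rule strongly_quasiconvex_onD) (use assms x in auto)
    also have "max (f x) (f x0) = f x" using R(1) R(2)[of x] x by (simp add: max_absorb1)
    finally show ?thesis by simp
  qed
  with that show ?thesis by blast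
qed

text \<open>Off \<open>K\<close> the quotient is infinite, so a bound on \<open>K\<close> far from
  the origin already forces the limit inferior to be at least \<open>c\<close>.\<close>

lemma supercoercive_onI:
  fixes f :: "'a::real_normed_vector \<Rightarrow> real"
  assumes "c > 0" and bound: "\<And>x. x \<in> K \<Longrightarrow> norm x \<ge> B \<Longrightarrow> f x \<ge> c * norm x ^ n"
  shows "supercoercive_on n K f"
proof -
  let ?g = "\<lambda>x. if x \<in> K then ereal (f x) else \<infinity>"
  have "\<forall>\<^sub>F x in at_infinity. ereal c \<le> ?g x / ereal (norm x ^ n)"
    unfolding eventually_at_infinity
  \<comment> \<open>The 1 makes the denominator positive.\<close>
  proof (intro exI[of _ "max B 1"] allI impI)
    fix x :: 'a
    assume x: "max B 1 \<le> norm x"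
    then have pos: "norm x ^ n > 0" by (intro zero_less_power) linarith
    show "ereal c \<le> ?g x / ereal (norm x ^ n)"
      using bound[of x] x pos by (auto simp: pos_le_divide_eq ereal_divide)
  qed
  then have "ereal c \<le> Liminf at_infinity (\<lambda>x. ?g x / ereal (norm x ^ n))"
    by (rule Liminf_bounded)
  with \<open>c > 0\<close> show ?thesis
    unfolding supercoercive_on_def supercoercive_def by (meson ereal_less(2) less_le_trans)
qed

theorem theorem4p2:
  fixes \<sigma> :: real
    and K :: "'a::real_normed_vector set"
    and f :: "'a \<Rightarrow> real"
    and x0 :: 'a
  assumes "\<exists>v::'a. v \<noteq> 0"
    and "\<sigma> > 0"
    and "K \<noteq> {}"
    and "convex K"
    and "strongly_quasiconvex_on \<sigma> K f"
    and "x0 \<in> K"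
    and "lsc_at_within x0 K f"
  shows "supercoercive_on 2 K f"
proof -
  obtain R where R: "\<And>x. x \<in> K \<Longrightarrow> norm (x - x0) \<ge> R \<Longrightarrow>
      f x \<ge> f x0 + \<sigma> / 8 * (norm (x - x0))\<^sup>2"
    using strongly_quasiconvex_on_quadratic_growth[OF assms(2,4-7)] by blast
  \<comment> \<open>The second entry gives \<open>norm (x - x0) \<ge> norm x / 2\<close>, and the
    third lifts this to at least \<open>R\<close>. The last, with \<open>norm x \<ge> 1\<close>,
    gives \<open>\<bar>f x0\<bar> \<le> \<sigma> / 64 * (norm x)\<^sup>2\<close>.\<close>
  define B where "B = Max {1, 2 * norm x0, 2 * R, 64 * \<bar>f x0\<bar> / \<sigma>}"
  show ?thesis
  \<comment> \<open>Halving the distance turns \<open>\<sigma> / 8\<close> into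
    \<open>\<sigma> / 32\<close>; half of that absorbs \<open>f x0\<close>, leaving
    \<open>\<sigma> / 64\<close>.\<close>
  proof (rule supercoercive_onI[where c = "\<sigma> / 64" and B = B])
    show "\<sigma> / 64 > 0" using assms(2) by simp
  next
    fix x
    assume x: "x \<in> K" "B \<le> norm x"
    then have B: "1 \<le> norm x" "2 * norm x0 \<le> norm x" "2 * R \<le> norm x"
        "64 * \<bar>f x0\<bar> / \<sigma> \<le> norm x"
      by (auto simp: B_def)
    have half: "norm (x - x0) \<ge> norm x / 2"
      using norm_triangle_ineq2[of x x0] B(2) by linarith
    then have "norm (x - x0) \<ge> R" using B(3) by linarith
    then have "f x \<ge> f x0 + \<sigma> / 8 * (norm (x - x0))\<^sup>2" using R x(1) by blast
    moreover have "\<sigma> / 8 * (norm (x - x0))\<^sup>2 \<ge> \<sigma> / 8 * (norm x / 2)\<^sup>2"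
      using half assms(2) by (intro mult_left_mono power_mono) auto
    moreover have "\<sigma> / 8 * (norm x / 2)\<^sup>2 = \<sigma> * (norm x)\<^sup>2 / 32" by (simp add: power_divide)
    moreover have "64 * \<bar>f x0\<bar> \<le> \<sigma> * norm x"
      using B(4) assms(2) by (simp add: pos_divide_le_eq mult.commute)
    moreover have "\<sigma> * norm x \<le> \<sigma> * (norm x)\<^sup>2"
      using B(1) assms(2) by (simp add: self_le_power)
    ultimately show "\<sigma> / 64 * (norm x)\<^sup>2 \<le> f x" by linarith
  qed
qed

end
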